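(* Let $\mathbb{A}$ be a finite alphabet with a pair $\pi=(<_D,<_A)$ of distinct total orders. For (nonempty) words $u,v$ over $\mathbb{A}$, if $i(u,v)=0$, then $\Delta(u,v)=0$.
   Context: For nonempty words $w,z$ put $w^\omega=www\cdots$ and $w^{-\omega}=\cdots www$. Write $w<_D z$ if $w^\omega$ is lexicographically smaller than $z^\omega$ with respect to $<_D$ (reading left to right), and $w<_A z$ if $w^{-\omega}$ is reverse-lexicographically smaller than $z^{-\omega}$ with respect to $<_A$ (reading right to left). $\Omega=(\Omega_{a,b})_{a,b\in\mathbb{A}}$ is the matrix with $\Omega_{a,b}=+1$ if $b<_A a$ and $a<_D b$; $\Omega_{a,b}=-1$ if $b<_D a$ and $a<_A b$; $0$ otherwise. $\Delta(u,v)=\lambda(u)^T\Omega\lambda(v)$, where $\lambda(w)=(|w|_a)_{a\in\mathbb{A}}$ is the Parikh vector of $w$ ($|w|_a$ is the number of occurrences of $a$ in $w$). Write $u=u_1\cdots u_s$, $v=v_1\cdots v_r$, indices of $u$ modulo $s$ and of $v$ modulo $r$; $u_{j+1}\cdots u_j$ denotes the conjugate $u_{j+1}\cdots u_su_1\cdots u_j$, and similarly $v_{i+1}\cdots v_i$. Let $R=\{(i,j):1\le i\le r,1\le j\le s\}$, $$T_1(u,v)=\{(i,j)\in R: v_i\ne u_j,\ u_{j+1}\cdots u_j<_A v_{i+1}\cdots v_i<_D u_{j+1}\cdots u_j\},$$ $$T_2(u,v)=\{(i,j)\in R: v_{i+1}\ne u_{j+1},\ v_{i+1}\cdots v_i<_A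 u_{j+1}\cdots u_j<_D v_{i+1}\cdots v_i\}.$$ The index is $i(u,v)=|T_1(u,v)|+|T_2(u,v)|$. *)

theory Defs
  imports Main "HOL-Library.Stream"
begin

text \<open>The alphabet is a finite type. The orders on it are strict order relations,
  \<open>rD\<close> for \<open><_D\<close> and \<open>rA\<close> for \<open><_A\<close>. Words are lists.\<close>

definition stream_lex :: "('a \<times> 'a) set \<Rightarrow> 'a stream \<Rightarrow> 'a stream \<Rightarrow> bool" where
  "stream_lex r x y \<longleftrightarrow> (\<exists>n. (\<forall>k<n. x !! k = y !! k) \<and> (x !! n, y !! n) \<in> r)"

definition less_D :: "('a \<times> 'a) set \<Rightarrow> 'a list \<Rightarrow> 'a list \<Rightarrow> bool" where
  "less_D rD w z \<longleftrightarrow> stream_lex rD (cycle w) (cycle z)"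

text \<open>The left-infinite word \<open>\<dots>www\<close> read from right to left is \<^term>\<open>cycle (rev w)\<close>.\<close>

definition less_A :: "('a \<times> 'a) set \<Rightarrow> 'a list \<Rightarrow> 'a list \<Rightarrow> bool" where
  "less_A rA w z \<longleftrightarrow> stream_lex rA (cycle (rev w)) (cycle (rev z))"

definition Omega :: "('a \<times> 'a) set \<Rightarrow> ('a \<times> 'a) set \<Rightarrow> 'a \<Rightarrow> 'a \<Rightarrow> int" where
  "Omega rD rA a b =
    (if (b, a) \<in> rA \<and> (a, b) \<in> rD then 1
     else if (b, a) \<in> rD \<and> (a, b) \<in> rA then - 1
     else 0)"

definition parikh :: "'a list \<Rightarrow> 'a \<Rightarrow> int" where
  "parikh w a = int (count_list w a)"

definition Delta ::
    "('a::finite \<times> 'a) set \<Rightarrow> ('a \<times> 'a) set \<Rightarrow> 'a list \<Rightarrow> 'a list \<Rightarrow> int" where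
  "Delta rD rA u v = (\<Sum>a\<in>UNIV. \<Sum>b\<in>UNIV. parikh u a * Omega rD rA a b * parikh v b)"

text \<open>Letters are numbered from 1, and positions are taken modulo the length, so for
  \<open>i \<ge> 1\<close> the \<open>i\<close>-th letter of \<open>w\<close> is \<open>letter w i\<close>, and \<open>letter w (length w + 1)\<close> is its
  first letter. With this numbering the conjugate of \<open>w\<close> starting with the letter at
  position \<open>i + 1\<close> and ending with the letter at position \<open>i\<close> is \<^term>\<open>rotate i w\<close>.\<close>

definition letter :: "'a list \<Rightarrow> nat \<Rightarrow> 'a" where
  "letter w i = w ! ((i - 1) mod length w)"

definition T1 ::
    "('a \<times> 'a) set \<Rightarrow> ('a \<times> 'a) set \<Rightarrow> 'a list \<Rightarrow> 'a list \<Rightarrow> (nat \<times> nat) set" where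
  "T1 rD rA u v = {(i, j) \<in> {1..length v} \<times> {1..length u}.
     letter v i \<noteq> letter u j \<and>
     less_A rA (rotate j u) (rotate i v) \<and>
     less_D rD (rotate i v) (rotate j u)}"

definition T2 ::
    "('a \<times> 'a) set \<Rightarrow> ('a \<times> 'a) set \<Rightarrow> 'a list \<Rightarrow> 'a list \<Rightarrow> (nat \<times> nat) set" where
  "T2 rD rA u v = {(i, j) \<in> {1..length v} \<times> {1..length u}.
     letter v (i + 1) \<noteq> letter u (j + 1) \<and>
     less_A rA (rotate i v) (rotate j u) \<and>
     less_D rD (rotate j u) (rotate i v)}"

definition index :: "('a \<times> 'a) set \<Rightarrow> ('a \<times> 'a) set \<Rightarrow> 'a list \<Rightarrow> 'a list \<Rightarrow> nat" where
  "index rD rA u v = card (T1 rD rA u v) + card (T2 rD rA u v)"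

end

theory Submission
  imports Defs
begin

text \<open>
  The reason is the identity \<open>\<Delta>(u,v) = |T\<^sub>2(u,v)| - |T\<^sub>1(u,v)|\<close>, valid for all nonempty words and
  proved below as \<open>Delta_eq_card_T2_minus_card_T1\<close>.

  Read \<open>u\<close> and \<open>v\<close> as periodic bi-infinite words. A pair \<open>(i,j)\<close> on the torus of indices modulo
  \<open>|v|\<close> and \<open>|u|\<close> is a way to cut both words; moving both cuts one letter to the right is the
  diagonal step \<open>(i,j) \<mapsto> (i+1,j+1)\<close>. At a cut let \<open>f\<close> say that the future of \<open>v\<close> is the larger one
  for \<open><\<^sub>D\<close>, and \<open>p\<close> that the past of \<open>v\<close> is the larger one for \<open><\<^sub>A\<close>. A step across two equal letters
  changes neither \<open>f\<close> nor \<open>p\<close>. A step across two different letters determines both \<open>f\<close> before the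
  step and \<open>p\<close> after it, and the entry of \<open>\<Omega>\<close> for these letters is exactly \<open>f\<close> (before) minus
  \<open>p\<close> (after), as \<open>0/1\<close> values. Equal letters contribute nothing to \<open>\<Delta>\<close>, so \<open>\<Delta>\<close> is the sum of
  these differences over the mismatching steps.

  A quantity that is constant across equal letters telescopes along the diagonals, so its sums over
  the mismatching steps agree whether it is evaluated before or after the step
  (\<open>sum_mismatch_shift\<close>). For \<open>p\<close> this turns \<open>\<Delta>\<close> into the sum of \<open>f - p\<close>, both taken just before
  a mismatch; the cuts with \<open>f\<close> and not \<open>p\<close> are \<open>T\<^sub>2\<close>. For the indicator of the cuts with \<open>p\<close> and
  not \<open>f\<close>, it moves the evaluation to just after a mismatch, and there these cuts are \<open>T\<^sub>1\<close>.
  Periodicity enters once more: a mismatch recurs in both directions, so next to it neither the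
  futures nor the pasts can be equal, and the negations of \<open>f\<close> and \<open>p\<close> are strict inequalities.
\<close>

section \<open>Lexicographic order on streams\<close>

lemma stream_lex_SCons:
  "stream_lex r (a ## x) (b ## y) \<longleftrightarrow> (a, b) \<in> r \<or> a = b \<and> stream_lex r x y" (is "?L \<longleftrightarrow> ?R")
proof
  assume ?L
  then obtain n where n: "\<And>k. k < n \<Longrightarrow> (a ## x) !! k = (b ## y) !! k"
    "((a ## x) !! n, (b ## y) !! n) \<in> r"
    unfolding stream_lex_def by blast
  show ?R
  proof (cases n)
    case 0
    then show ?thesis using n(2) by simp
  next
    case (Suc m)
    have "a = b" using n(1)[of 0] Suc by simp
    moreover have "x !! k = y !! k" if "k < m" for k
      using n(1)[of "Suc k"] that Suc by simp
    moreover have "(x !! m, y !! m) \<in> r" using n(2) Suc by simp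
    ultimately show ?thesis unfolding stream_lex_def by blast
  qed
next
  assume ?R
  then show ?L
  proof
    assume "(a, b) \<in> r"
    then have "(\<forall>k<0. (a ## x) !! k = (b ## y) !! k) \<and> ((a ## x) !! 0, (b ## y) !! 0) \<in> r"
      by simp
    then show ?L unfolding stream_lex_def by blast
  next
    assume R: "a = b \<and> stream_lex r x y"
    then obtain n where "\<forall>k<n. x !! k = y !! k" "(x !! n, y !! n) \<in> r"
      unfolding stream_lex_def by blast
    then have "(\<forall>k<Suc n. (a ## x) !! k = (b ## y) !! k) \<and>
        ((a ## x) !! Suc n, (b ## y) !! Suc n) \<in> r"
      using R by (simp add: All_less_Suc2)
    then show ?L unfolding stream_lex_def by blast
  qed
qed

lemma stream_lex_flip:
  assumes r: "strict_linear_order_on UNIV r" and "x \<noteq> y"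
  shows "stream_lex r x y \<longleftrightarrow> \<not> stream_lex r y x"
proof -
  obtain n where "x !! n \<noteq> y !! n" and least: "\<And>k. k < n \<Longrightarrow> x !! k = y !! k"
  proof -
    obtain n0 where "x !! n0 \<noteq> y !! n0"
      using \<open>x \<noteq> y\<close> smap_alt[of id x y] by (auto simp: stream.map_id)
    then show ?thesis using that exists_least_iff[of "\<lambda>n. x !! n \<noteq> y !! n"] by blast
  qed
  have "stream_lex r a b \<longleftrightarrow> (a !! n, b !! n) \<in> r"
    if "a !! n \<noteq> b !! n" and "\<And>k. k < n \<Longrightarrow> a !! k = b !! k" for a b :: "'a stream"
  proof
    assume "stream_lex r a b"
    then obtain m where m: "\<And>k. k < m \<Longrightarrow> a !! k = b !! k" "(a !! m, b !! m) \<in> r"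
      unfolding stream_lex_def by blast
    have "a !! m \<noteq> b !! m"
      using m(2) r by (auto simp: strict_linear_order_on_def irrefl_def)
    then have "m = n" using m(1) that by (metis nat_neq_iff)
    then show "(a !! n, b !! n) \<in> r" using m by simp
  next
    assume "(a !! n, b !! n) \<in> r"
    then show "stream_lex r a b" using that unfolding stream_lex_def by blast
  qed
  from this[of x y] this[of y x] \<open>x !! n \<noteq> y !! n\<close> least
  have "stream_lex r x y \<longleftrightarrow> (x !! n, y !! n) \<in> r" "stream_lex r y x \<longleftrightarrow> (y !! n, x !! n) \<in> r"
    by (metis, metis)
  then show ?thesis
    using r \<open>x !! n \<noteq> y !! n\<close>
    unfolding strict_linear_order_on_def total_on_def irrefl_def trans_def by blast
qed

section \<open>Futures and pasts of conjugates\<close>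

lemma cycle_rotate:
  assumes "w \<noteq> []"
  shows "cycle (rotate i w) = w ! (i mod length w) ## cycle (rotate (Suc i) w)"
proof -
  have "hd (rotate i w) = w ! (i mod length w)" using assms by (simp add: hd_rotate_conv_nth)
  moreover have "rotate i w \<noteq> []" using assms by simp
  ultimately show ?thesis
    by (cases "rotate i w") (simp_all add: cycle_Cons)
qed

lemma cycle_rev_rotate_Suc:
  assumes "w \<noteq> []"
  shows "cycle (rev (rotate (Suc i) w)) = w ! (i mod length w) ## cycle (rev (rotate i w))"
proof -
  have "hd (rotate i w) = w ! (i mod length w)" using assms by (simp add: hd_rotate_conv_nth)
  moreover have "rotate i w \<noteq> []" using assms by simp
  ultimately show ?thesis
    by (cases "rotate i w") (simp_all add: cycle_Cons)
qed

lemma less_D_rotate: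
  assumes "w \<noteq> []" "z \<noteq> []"
  shows "less_D r (rotate j w) (rotate i z) \<longleftrightarrow>
    (w ! (j mod length w), z ! (i mod length z)) \<in> r \<or>
    w ! (j mod length w) = z ! (i mod length z) \<and>
      less_D r (rotate (Suc j) w) (rotate (Suc i) z)"
  unfolding less_D_def cycle_rotate[OF assms(1), of j] cycle_rotate[OF assms(2), of i]
  by (rule stream_lex_SCons)

lemma less_A_rotate_Suc:
  assumes "w \<noteq> []" "z \<noteq> []"
  shows "less_A r (rotate (Suc j) w) (rotate (Suc i) z) \<longleftrightarrow>
    (w ! (j mod length w), z ! (i mod length z)) \<in> r \<or>
    w ! (j mod length w) = z ! (i mod length z) \<and> less_A r (rotate j w) (rotate i z)"
  unfolding less_A_def cycle_rev_rotate_Suc[OF assms(1)] cycle_rev_rotate_Suc[OF assms(2)]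
  by (rule stream_lex_SCons)

text \<open>
  Both infinite words complete a period after \<open>|w|\<cdot>|z|\<close> letters, and there each has just read the
  last letter of its own period.
\<close>

lemma cycle_eq_imp_last_eq:
  assumes "w \<noteq> []" "z \<noteq> []" "cycle w = cycle z"
  shows "last w = last z"
proof -
  have nth: "cycle x !! (length x * n - 1) = last x" if "x \<noteq> []" "n > 0" for x :: "'a list" and n
  proof -
    obtain m where "n = Suc m" using \<open>n > 0\<close> by (cases n) auto
    then have "length x * n - 1 = (length x - 1) + length x * m"
      using that(1) by (cases x) simp_all
    then have "(length x * n - 1) mod length x = length x - 1"
      using that(1) by simp
    then show ?thesis using that(1)
      by (simp add: sdrop_cycle hd_rotate_conv_nth last_conv_nth flip: sdrop_simps(1))
  qed
  show ?thesis
    using nth[of w "length z"] nth[of z "length w"] assms by (simp add: mult.commute)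
qed

text \<open>
  The letters just read are the last ones of the two conjugates, so if they differ the futures
  differ too, although these futures start only after the mismatch.
\<close>

lemma less_D_flip_after_mismatch:
  assumes "strict_linear_order_on UNIV r" "w \<noteq> []" "z \<noteq> []"
    and "w ! (i mod length w) \<noteq> z ! (j mod length z)"
  shows "less_D r (rotate (Suc i) w) (rotate (Suc j) z) \<longleftrightarrow>
    \<not> less_D r (rotate (Suc j) z) (rotate (Suc i) w)"
proof -
  have last: "last (rotate (Suc k) x) = x ! (k mod length x)" if "x \<noteq> []" for x :: "'a list" and k
    using that hd_rotate_conv_nth[OF that, of k]
    by (cases "rotate k x") (auto simp: rotate_Suc)
  have "cycle (rotate (Suc i) w) \<noteq> cycle (rotate (Suc j) z)"
    using cycle_eq_imp_last_eq[of "rotate (Suc i) w" "rotate (Suc j) z"] assms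
    by (auto simp: last simp del: rotate_Suc)
  then show ?thesis unfolding less_D_def by (rule stream_lex_flip[OF assms(1)])
qed

text \<open>
  The mirror image: the letters about to be read are the ones that the pasts read last in each
  period.
\<close>

lemma less_A_flip_before_mismatch:
  assumes "strict_linear_order_on UNIV r" "w \<noteq> []" "z \<noteq> []"
    and "w ! (i mod length w) \<noteq> z ! (j mod length z)"
  shows "less_A r (rotate i w) (rotate j z) \<longleftrightarrow> \<not> less_A r (rotate j z) (rotate i w)"
proof -
  have "cycle (rev (rotate i w)) \<noteq> cycle (rev (rotate j z))"
    using cycle_eq_imp_last_eq[of "rev (rotate i w)" "rev (rotate j z)"] assms
    by (auto simp: last_rev hd_rotate_conv_nth)
  then show ?thesis unfolding less_A_def by (rule stream_lex_flip[OF assms(1)])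
qed

section \<open>Summation over the torus of positions\<close>

lemma sum_torus_shift:
  fixes h :: "nat \<Rightarrow> nat \<Rightarrow> int"
  assumes "\<And>j. h m j = h 0 j" "\<And>i. h i n = h i 0"
  shows "(\<Sum>i<m. \<Sum>j<n. h (Suc i) (Suc j)) = (\<Sum>i<m. \<Sum>j<n. h i j)"
proof -
  have cyc: "(\<Sum>k<l. g (Suc k)) = (\<Sum>k<l. g k)" if "g l = g 0" for g :: "nat \<Rightarrow> int" and l
    using sum.lessThan_Suc_shift[of g l] that by simp
  have "(\<Sum>i<m. \<Sum>j<n. h (Suc i) (Suc j)) = (\<Sum>i<m. \<Sum>j<n. h (Suc i) j)"
    by (intro sum.cong refl cyc assms)
  also have "\<dots> = (\<Sum>i<m. \<Sum>j<n. h i j)"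
    by (rule cyc) (simp add: assms)
  finally show ?thesis .
qed

text \<open>
  The increments \<open>h(i,j) - h(i+1,j+1)\<close> vanish off \<open>M\<close> and sum to zero over the whole torus, hence
  they already sum to zero over \<open>M\<close>.
\<close>

lemma sum_mismatch_shift:
  fixes h :: "nat \<Rightarrow> nat \<Rightarrow> int"
  assumes "\<And>j. h m j = h 0 j" "\<And>i. h i n = h i 0"
    and const: "\<And>i j. \<not> M i j \<Longrightarrow> h (Suc i) (Suc j) = h i j"
  shows "(\<Sum>i<m. \<Sum>j<n. of_bool (M i j) * h (Suc i) (Suc j)) =
    (\<Sum>i<m. \<Sum>j<n. of_bool (M i j) * h i j)"
proof -
  have "(\<Sum>i<m. \<Sum>j<n. of_bool (M i j) * h (Suc i) (Suc j) - of_bool (M i j) * h i j) =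
      (\<Sum>i<m. \<Sum>j<n. h (Suc i) (Suc j) - h i j)"
    by (intro sum.cong refl) (simp add: const)
  also have "\<dots> = 0"
    using sum_torus_shift[of h m n] assms(1,2) by (simp add: sum_subtractf)
  finally show ?thesis by (simp add: sum_subtractf)
qed

lemma sum_parikh:
  fixes g :: "'a::finite \<Rightarrow> int"
  shows "(\<Sum>a\<in>UNIV. parikh w a * g a) = (\<Sum>k<length w. g (w ! k))"
proof (induction w)
  case Nil
  show ?case by (simp add: parikh_def)
next
  case (Cons x w)
  have "(\<Sum>a\<in>UNIV. parikh (x # w) a * g a) =
      (\<Sum>a\<in>UNIV. (if a = x then g a else 0) + parikh w a * g a)"
    by (intro sum.cong refl) (auto simp: parikh_def algebra_simps)
  also have "\<dots> = g x + (\<Sum>a\<in>UNIV. parikh w a * g a)"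
    by (simp add: sum.distrib)
  finally show ?case using Cons.IH by (simp add: sum.lessThan_Suc_shift del: sum.lessThan_Suc)
qed

lemma Delta_eq_sum_positions:
  "Delta rD rA u v = (\<Sum>i<length v. \<Sum>j<length u. Omega rD rA (u ! j) (v ! i))"
proof -
  have "Delta rD rA u v =
      (\<Sum>a\<in>UNIV. parikh u a * (\<Sum>b\<in>UNIV. parikh v b * Omega rD rA a b))"
    unfolding Delta_def by (simp add: sum_distrib_left mult_ac)
  also have "\<dots> = (\<Sum>j<length u. \<Sum>i<length v. Omega rD rA (u ! j) (v ! i))"
    by (simp add: sum_parikh)
  finally show ?thesis by (simp add: sum.swap[of _ "{..<length u}"])
qed

lemma card_torus_Suc:
  fixes m n :: nat
  shows "int (card {(i, j) \<in> {1..m} \<times> {1..n}. P i j}) =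
    (\<Sum>i<m. \<Sum>j<n. of_bool (P (Suc i) (Suc j)))"
proof -
  have "{(i, j) \<in> {1..m} \<times> {1..n}. P i j} =
      {p \<in> {1..m} \<times> {1..n}. case p of (i, j) \<Rightarrow> P i j}" by auto
  then have "int (card {(i, j) \<in> {1..m} \<times> {1..n}. P i j}) =
      (\<Sum>p\<in>{1..m} \<times> {1..n}. of_bool (case p of (i, j) \<Rightarrow> P i j))"
    by (simp add: sum_of_bool_eq Collect_conj_eq)
  also have "\<dots> = (\<Sum>i\<in>{1..m}. \<Sum>j\<in>{1..n}. of_bool (P i j))"
    by (simp only: sum.cartesian_product split_def)
  finally show ?thesis by (simp only: One_nat_def sum.atLeast1_atMost_eq)
qed

section \<open>The form \<open>\<Delta>\<close> as a difference of two counts\<close>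

lemma Delta_eq_card_T2_minus_card_T1:
  fixes rD rA :: "('a::finite \<times> 'a) set"
  assumes D: "strict_linear_order_on UNIV rD" and A: "strict_linear_order_on UNIV rA"
    and u: "u \<noteq> []" and v: "v \<noteq> []"
  shows "Delta rD rA u v = int (card (T2 rD rA u v)) - int (card (T1 rD rA u v))"
proof -
  define r s where "r = length v" and "s = length u"
  define m where "m i j \<longleftrightarrow> u ! (j mod s) \<noteq> v ! (i mod r)" for i j
  define f where "f i j \<longleftrightarrow> less_D rD (rotate j u) (rotate i v)" for i j
  define p where "p i j \<longleftrightarrow> less_A rA (rotate j u) (rotate i v)" for i j

  have f_step: "f i j \<longleftrightarrow> (u ! (j mod s), v ! (i mod r)) \<in> rD \<or> \<not> m i j \<and> f (Suc i) (Suc j)"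
    for i j unfolding f_def m_def r_def s_def using less_D_rotate[OF u v, of rD j i] by simp
  have p_step: "p (Suc i) (Suc j) \<longleftrightarrow> (u ! (j mod s), v ! (i mod r)) \<in> rA \<or> \<not> m i j \<and> p i j"
    for i j unfolding p_def m_def r_def s_def using less_A_rotate_Suc[OF u v, of rA j i] by simp
  have irrefl: "(a, a) \<notin> rD" "(a, a) \<notin> rA" for a
    using D A by (auto simp: strict_linear_order_on_def irrefl_def)
  have f_const: "f (Suc i) (Suc j) = f i j" if "\<not> m i j" for i j
    using that irrefl f_step[of i j] by (auto simp: m_def)
  have p_const: "p (Suc i) (Suc j) = p i j" if "\<not> m i j" for i j
    using that irrefl p_step[of i j] by (auto simp: m_def)
  have per: "m r j = m 0 j" "m i s = m i 0" "f r j = f 0 j" "f i s = f i 0"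
      "p r j = p 0 j" "p i s = p i 0" for i j
    unfolding m_def f_def p_def r_def s_def by simp_all

  have letter: "letter v (Suc i) \<noteq> letter u (Suc j) \<longleftrightarrow> m i j" for i j
    by (auto simp: letter_def m_def r_def s_def)
  have not_p: "less_A rA (rotate i v) (rotate j u) \<longleftrightarrow> \<not> p i j" if "m i j" for i j
    using less_A_flip_before_mismatch[OF A v u, of i j] that
    unfolding m_def p_def r_def s_def by metis
  have not_f: "less_D rD (rotate (Suc i) v) (rotate (Suc j) u) \<longleftrightarrow> \<not> f (Suc i) (Suc j)"
    if "m i j" for i j
    using less_D_flip_after_mismatch[OF D v u, of i j] that
    unfolding m_def f_def r_def s_def by metis

  have Omega: "Omega rD rA (u ! (j mod s)) (v ! (i mod r)) =
      of_bool (m i j) * (of_bool (f i j) - of_bool (p (Suc i) (Suc j)))" for i j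
  proof (cases "m i j")
    case True
    define a b where "a = u ! (j mod s)" and "b = v ! (i mod r)"
    have "a \<noteq> b" using True by (simp add: m_def a_def b_def)
    then have "(b, a) \<in> rD \<longleftrightarrow> (a, b) \<notin> rD" "(b, a) \<in> rA \<longleftrightarrow> (a, b) \<notin> rA"
      using D A unfolding strict_linear_order_on_def total_on_def irrefl_def trans_def by blast+
    moreover have "f i j \<longleftrightarrow> (a, b) \<in> rD" "p (Suc i) (Suc j) \<longleftrightarrow> (a, b) \<in> rA"
      using f_step[of i j] p_step[of i j] True by (simp_all add: a_def b_def)
    ultimately show ?thesis
      using True by (auto simp: Omega_def simp flip: a_def b_def)
  next
    case False
    then show ?thesis using irrefl by (simp add: m_def Omega_def)
  qed

  \<comment> \<open>Cuts are taken modulo \<open>r\<close> and \<open>s\<close>, so numbering the cuts from 1 or from 0 is the same;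
    the mismatch in \<open>T\<^sub>2\<close> is the one to the right of the cut.\<close>
  have T2: "int (card (T2 rD rA u v)) = (\<Sum>i<r. \<Sum>j<s. of_bool (m i j) * of_bool (f i j \<and> \<not> p i j))"
  proof -
    have "T2 rD rA u v = {(i, j) \<in> {1..r} \<times> {1..s}. m i j \<and> f i j \<and> \<not> p i j}"
      unfolding T2_def Suc_eq_plus1[symmetric] letter f_def[symmetric] r_def[symmetric]
        s_def[symmetric] by (auto simp: not_p)
    then have "int (card (T2 rD rA u v)) = (\<Sum>i<r. \<Sum>j<s. of_bool
        (m (Suc i) (Suc j) \<and> f (Suc i) (Suc j) \<and> \<not> p (Suc i) (Suc j)))"
      by (simp only: card_torus_Suc)
    also have "\<dots> = (\<Sum>i<r. \<Sum>j<s. of_bool (m i j \<and> f i j \<and> \<not> p i j))"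
      by (rule sum_torus_shift[of "\<lambda>i j. of_bool (m i j \<and> f i j \<and> \<not> p i j)"]) (simp_all add: per)
    finally show ?thesis by (simp add: of_bool_conj)
  qed

  \<comment> \<open>The mismatch in \<open>T\<^sub>1\<close> is to the left of the cut, so with the sum indexed by the mismatch the
    cut is \<open>(i + 1, j + 1)\<close>.\<close>
  have T1: "int (card (T1 rD rA u v)) =
      (\<Sum>i<r. \<Sum>j<s. of_bool (m i j) * of_bool (p (Suc i) (Suc j) \<and> \<not> f (Suc i) (Suc j)))"
  proof -
    have "int (card (T1 rD rA u v)) = (\<Sum>i<r. \<Sum>j<s. of_bool
        (m i j \<and> p (Suc i) (Suc j) \<and>
          less_D rD (rotate (Suc i) v) (rotate (Suc j) u)))"
      unfolding T1_def p_def r_def s_def card_torus_Suc letter ..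
    also have "\<dots> =
        (\<Sum>i<r. \<Sum>j<s. of_bool (m i j \<and> p (Suc i) (Suc j) \<and> \<not> f (Suc i) (Suc j)))"
      by (intro sum.cong refl arg_cong[where f = of_bool]) (metis not_f)
    finally show ?thesis by (simp add: of_bool_conj)
  qed

  have "Delta rD rA u v = (\<Sum>i<r. \<Sum>j<s. Omega rD rA (u ! (j mod s)) (v ! (i mod r)))"
    unfolding Delta_eq_sum_positions r_def s_def by simp
  also have "\<dots> = (\<Sum>i<r. \<Sum>j<s. of_bool (m i j) * of_bool (f i j))
      - (\<Sum>i<r. \<Sum>j<s. of_bool (m i j) * of_bool (p (Suc i) (Suc j)))"
    unfolding Omega right_diff_distrib sum_subtractf ..
  also have "(\<Sum>i<r. \<Sum>j<s. of_bool (m i j) * of_bool (p (Suc i) (Suc j))) =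
      (\<Sum>i<r. \<Sum>j<s. of_bool (m i j) * of_bool (p i j) :: int)"
    by (rule sum_mismatch_shift[of "\<lambda>i j. of_bool (p i j)"]) (simp_all add: per p_const)
  \<comment> \<open>Cuts where \<open>f\<close> and \<open>p\<close> agree cancel.\<close>
  also have "(\<Sum>i<r. \<Sum>j<s. of_bool (m i j) * of_bool (f i j)) - \<dots> =
      (\<Sum>i<r. \<Sum>j<s. of_bool (m i j) * of_bool (f i j \<and> \<not> p i j)) -
      (\<Sum>i<r. \<Sum>j<s. of_bool (m i j) * of_bool (p i j \<and> \<not> f i j))"
    unfolding sum_subtractf[symmetric] by (intro sum.cong refl) auto
  also have "(\<Sum>i<r. \<Sum>j<s. of_bool (m i j) * of_bool (p i j \<and> \<not> f i j)) =
      int (card (T1 rD rA u v))"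
    unfolding T1
    by (rule sum_mismatch_shift[of "\<lambda>i j. of_bool (p i j \<and> \<not> f i j)", symmetric])
      (simp_all add: per p_const f_const)
  finally show ?thesis unfolding T2 .
qed

theorem corollary5:
  fixes rD rA :: "('a::finite \<times> 'a) set" and u v :: "'a list"
  assumes "strict_linear_order_on UNIV rD"
    and "strict_linear_order_on UNIV rA"
    and "rD \<noteq> rA"
    and "u \<noteq> []"
    and "v \<noteq> []"
    and "index rD rA u v = 0"
  shows "Delta rD rA u v = 0"
  using Delta_eq_card_T2_minus_card_T1[OF assms(1,2,4,5)] assms(6) by (simp add: index_def)

end
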